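(* For any $\varepsilon>0$ there is a positive integer $p(\varepsilon)$ such that for all integers $p\ge p(\varepsilon)$ $$\mathcal{M}^{\mathrm{EE}}_p(\mathcal{S}_p\cap\mathbb{C}_{-,0})\le\frac{\left(\frac{1+\frac1e+\varepsilon}{W(1/e)}\right)^p}{\left(2+\frac2e+2\varepsilon\right)\pi\sqrt{p-1}}<\frac{(4.92+3.6\varepsilon)^p}{\left(2+\frac2e+2\varepsilon\right)\pi\sqrt{p-1}}.$$
   Context: Explicit Euler (EE) extrapolation of order $p\ge2$ on the test equation $U'=\lambda U$, with $z=\tau\lambda\in\mathbb{C}$ and internal perturbations: given $U_n$ and residuals $\tilde r_{m,j}\in\mathbb{C}$ ($1\le m\le p$, $1\le j\le m$), set $$\widetilde Y_{m,0}=U_n,\qquad \widetilde Y_{m,j}=\Big(1+\frac zm\Big)\widetilde Y_{m,j-1}+\tilde r_{m,j}\ (1\le j\le m),\qquad T_{m,1}=\widetilde Y_{m,m},$$ $$T_{j,k}=T_{j,k-1}+\frac{T_{j,k-1}-T_{j-1,k-1}}{\frac{j}{j-k+1}-1}\quad(2\le k\le j\le p),\qquad U_{n+1}=T_{p,p}.$$ Then $U_{n+1}=P(z)U_n+\sum_{m=1}^p\sum_{\ell=1}^mQ^{\mathrm{EE}}_{p,m,\ell}(z)\,\tilde r_{m,\ell}$, which defines the internal stability polynomials $Q^{\mathrm{EE}}_{p,m,\ell}$. For $\mathcal{S}\subset\mathbb{C}$, $$\mathcal{M}^{\mathrm{EE}}_p(\mathcal{S}):=\max_{1\le m\le p}\max_{1\le\ell\le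 m}\sup_{z\in\mathcal{S}}|Q^{\mathrm{EE}}_{p,m,\ell}(z)|.$$ The absolute stability region of the method is $\mathcal{S}_p=\{z\in\mathbb{C}:|\sum_{k=0}^pz^k/k!|\le1\}$, and $\mathbb{C}_{-,0}=\{z\in\mathbb{C}:\operatorname{Re}z\le0\}$. $W$ is the Lambert function: for $x\ge-1/e$, $W(x)\ge-1$ is the unique number with $W(x)e^{W(x)}=x$. *)

theory Defs
  imports Complex_Main "HOL-Computational_Algebra.Polynomial" "HOL-Library.Extended_Real"
begin

primrec ee_Y :: "complex \<Rightarrow> complex \<Rightarrow> (nat \<Rightarrow> nat \<Rightarrow> complex) \<Rightarrow> nat \<Rightarrow> nat \<Rightarrow> complex" where
  "ee_Y z U r m 0 = U"
| "ee_Y z U r m (Suc j) = (1 + z / of_nat m) * ee_Y z U r m j + r m (Suc j)"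

text \<open>Only the entries with \<open>1 \<le> k \<le> j\<close> are meaningful; the value at \<open>k = 0\<close> is junk.\<close>

fun ee_T :: "complex \<Rightarrow> complex \<Rightarrow> (nat \<Rightarrow> nat \<Rightarrow> complex) \<Rightarrow> nat \<Rightarrow> nat \<Rightarrow> complex" where
  "ee_T z U r j 0 = 0"
| "ee_T z U r j (Suc 0) = ee_Y z U r j j"
| "ee_T z U r j (Suc (Suc k)) =
     ee_T z U r j (Suc k) +
     (ee_T z U r j (Suc k) - ee_T z U r (j - 1) (Suc k)) /
       (of_nat j / (of_nat j - of_nat (Suc (Suc k)) + 1) - 1)"

definition ee_step :: "nat \<Rightarrow> complex \<Rightarrow> complex \<Rightarrow> (nat \<Rightarrow> nat \<Rightarrow> complex) \<Rightarrow> complex" where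
  "ee_step p z U r = ee_T z U r p p"

definition ee_repr ::
  "(complex \<Rightarrow> complex \<Rightarrow> (nat \<Rightarrow> nat \<Rightarrow> complex) \<Rightarrow> complex) \<Rightarrow> nat \<Rightarrow>
   complex poly \<Rightarrow> (nat \<Rightarrow> nat \<Rightarrow> complex poly) \<Rightarrow> bool" where
  "ee_repr F p P Q \<longleftrightarrow>
     (\<forall>z U r. F z U r = poly P z * U + (\<Sum>m=1..p. \<Sum>l=1..m. poly (Q m l) z * r m l))"

text \<open>
  The internal stability polynomials are the coefficients of the residuals in the representation
  of the step. The indices \<open>1 \<le> l \<le> m \<le> p\<close> are the meaningful ones, and for them
  \<open>ee_Q_ex1\<close> below shows that the definite description is proper.
\<close>

definition ee_Q :: "nat \<Rightarrow> nat \<Rightarrow> nat \<Rightarrow> complex poly" where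
  "ee_Q p m l = (THE q. \<exists>P Q. ee_repr (ee_step p) p P Q \<and> Q m l = q)"

text \<open>The supremum is taken in the extended reals, since it is infinite for general \<open>S\<close>.\<close>

definition ee_M :: "nat \<Rightarrow> complex set \<Rightarrow> ereal" where
  "ee_M p S = (MAX m\<in>{1..p}. MAX l\<in>{1..m}. SUP z\<in>S. ereal (cmod (poly (ee_Q p m l) z)))"

definition stab_region :: "nat \<Rightarrow> complex set" where
  "stab_region p = {z. cmod (\<Sum>k=0..p. z ^ k / fact k) \<le> 1}"

definition left_half_plane :: "complex set" where
  "left_half_plane = {z. Re z \<le> 0}"

text \<open>Principal branch; meaningful for \<open>x \<ge> - 1 / exp 1\<close>, see \<open>lambert_W_ex1\<close>.\<close>

definition lambert_W :: "real \<Rightarrow> real" where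
  "lambert_W x = (THE w. w \<ge> - 1 \<and> w * exp w = x)"


subsection \<open>The definite descriptions are proper\<close>

lemma ee_repr_add:
  assumes "ee_repr F p P Q" "ee_repr G p P' Q'"
  shows "ee_repr (\<lambda>z U r. F z U r + G z U r) p (P + P') (\<lambda>m l. Q m l + Q' m l)"
  using assms unfolding ee_repr_def by (simp add: algebra_simps sum.distrib)

lemma ee_repr_mult:
  assumes "ee_repr F p P Q"
  shows "ee_repr (\<lambda>z U r. poly a z * F z U r) p (a * P) (\<lambda>m l. a * Q m l)"
  using assms unfolding ee_repr_def by (simp add: algebra_simps sum_distrib_left)

lemma ee_repr_U: "ee_repr (\<lambda>z U r. U) p 1 (\<lambda>m l. 0)"
  unfolding ee_repr_def by simp

lemma double_sum_unit:
  fixes f :: "nat \<Rightarrow> nat \<Rightarrow> 'a::semiring_1"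
  assumes "1 \<le> l" "l \<le> m" "m \<le> p"
  shows "(\<Sum>i=1..p. \<Sum>j=1..i. f i j * (if i = m \<and> j = l then 1 else 0)) = f m l"
proof -
  have "(\<Sum>j=1..i. f i j * (if i = m \<and> j = l then 1 else 0)) = (if i = m then f m l else 0)" for i
    using assms by (cases "i = m") (auto simp: if_distrib[of "times _"] cong: if_cong)
  then show ?thesis using assms by simp
qed

lemma ee_repr_r:
  assumes "1 \<le> l" "l \<le> m" "m \<le> p"
  shows "ee_repr (\<lambda>z U r. r m l) p 0 (\<lambda>i j. if i = m \<and> j = l then 1 else 0)"
  unfolding ee_repr_def
proof (intro allI)
  fix z U :: complex and r :: "nat \<Rightarrow> nat \<Rightarrow> complex"
  have "(\<Sum>i=1..p. \<Sum>j=1..i. poly (if i = m \<and> j = l then 1 else 0) z * r i j)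
      = (\<Sum>i=1..p. \<Sum>j=1..i. r i j * (if i = m \<and> j = l then 1 else 0))"
    by (intro sum.cong) auto
  then show "r m l = poly 0 z * U +
      (\<Sum>i=1..p. \<Sum>j=1..i. poly (if i = m \<and> j = l then 1 else 0) z * r i j)"
    using double_sum_unit[OF assms, of r] by simp
qed

lemma ee_repr_Y:
  assumes "j \<le> m" "m \<le> p"
  shows "\<exists>P Q. ee_repr (\<lambda>z U r. ee_Y z U r m j) p P Q"
  using assms
proof (induction j)
  case 0
  then show ?case using ee_repr_U by auto
next
  case (Suc j)
  then obtain P Q where "ee_repr (\<lambda>z U r. ee_Y z U r m j) p P Q" by auto
  from ee_repr_add[OF ee_repr_mult[OF this, of "[:1, 1 / of_nat m:]"] ee_repr_r[of "Suc j" m p]]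
  show ?case using Suc.prems by auto
qed

lemma ee_repr_T:
  assumes "j \<le> p"
  shows "\<exists>P Q. ee_repr (\<lambda>z U r. ee_T z U r j (Suc k)) p P Q"
  using assms
proof (induction k arbitrary: j)
  case 0
  then show ?case using ee_repr_Y[of j j p] by simp
next
  case (Suc k)
  define c :: complex where "c = of_nat j / (of_nat j - of_nat (Suc (Suc k)) + 1) - 1"
  from Suc.IH[of j] Suc.prems obtain P Q
    where 1: "ee_repr (\<lambda>z U r. ee_T z U r j (Suc k)) p P Q" by auto
  have "j - 1 \<le> p" using Suc.prems by simp
  from Suc.IH[OF this] obtain P' Q'
    where 2: "ee_repr (\<lambda>z U r. ee_T z U r (j - 1) (Suc k)) p P' Q'" by blast
  have eq: "ee_T z U r j (Suc (Suc k)) =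
      poly [:1 + 1 / c:] z * ee_T z U r j (Suc k) +
      poly [:- (1 / c):] z * ee_T z U r (j - 1) (Suc k)" for z U r
    by (simp only: ee_T.simps c_def[symmetric])
       (simp add: algebra_simps diff_divide_distrib)
  show ?case
    unfolding eq using ee_repr_add[OF ee_repr_mult[OF 1] ee_repr_mult[OF 2]] by blast
qed

lemma ee_repr_ex:
  assumes "p \<ge> 1"
  shows "\<exists>P Q. ee_repr (ee_step p) p P Q"
proof -
  have "ee_step p = (\<lambda>z U r. ee_T z U r p (Suc (p - 1)))"
    using assms by (intro ext) (simp add: ee_step_def)
  then show ?thesis using ee_repr_T[of p p "p - 1"] by simp
qed

lemma ee_repr_unique:
  assumes "ee_repr F p P Q" "1 \<le> l" "l \<le> m" "m \<le> p"
  shows "poly (Q m l) z = F z 0 (\<lambda>i j. if i = m \<and> j = l then 1 else 0)"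
  using assms(1) double_sum_unit[OF assms(2-4), of "\<lambda>i j. poly (Q i j) z"]
  unfolding ee_repr_def by simp

lemma ee_Q_ex1:
  assumes "1 \<le> l" "l \<le> m" "m \<le> p"
  shows "\<exists>!q. \<exists>P Q. ee_repr (ee_step p) p P Q \<and> Q m l = q"
proof -
  obtain P Q where 0: "ee_repr (ee_step p) p P Q"
    using ee_repr_ex[of p] assms by auto
  show ?thesis
  proof (rule ex1I[of _ "Q m l"])
    show "\<exists>P' Q'. ee_repr (ee_step p) p P' Q' \<and> Q' m l = Q m l" using 0 by auto
  next
    fix q assume "\<exists>P' Q'. ee_repr (ee_step p) p P' Q' \<and> Q' m l = q"
    then obtain P' Q' where 1: "ee_repr (ee_step p) p P' Q'" "Q' m l = q" by auto
    have "poly q = poly (Q m l)"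
      using ee_repr_unique[OF 0 assms] ee_repr_unique[OF 1(1) assms] 1(2) by (intro ext) auto
    then show "q = Q m l" by (simp add: poly_eq_poly_eq_iff)
  qed
qed

lemma ee_Q_repr:
  assumes "p \<ge> 1"
  shows "\<exists>P. ee_repr (ee_step p) p P (ee_Q p)"
proof -
  obtain P Q where 0: "ee_repr (ee_step p) p P Q"
    using ee_repr_ex[OF assms] by auto
  have "ee_Q p m l = Q m l" if "1 \<le> l" "l \<le> m" "m \<le> p" for m l
    unfolding ee_Q_def using ee_Q_ex1[OF that] 0 by (intro the1_equality) auto
  then have "(\<Sum>m=1..p. \<Sum>l=1..m. poly (ee_Q p m l) z * r m l) =
      (\<Sum>m=1..p. \<Sum>l=1..m. poly (Q m l) z * r m l)" for z and r :: "nat \<Rightarrow> nat \<Rightarrow> complex"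
    by (intro sum.cong) auto
  then show ?thesis using 0 unfolding ee_repr_def by auto
qed

lemma strict_mono_mult_exp:
  fixes v w :: real
  assumes "- 1 \<le> v" "v < w"
  shows "v * exp v < w * exp w"
proof (rule DERIV_pos_imp_increasing_open[OF assms(2)])
  fix x assume "v < x" "x < w"
  have "((\<lambda>x. x * exp x) has_real_derivative (1 + x) * exp x) (at x)"
    by (auto intro!: derivative_eq_intros simp: algebra_simps)
  moreover have "0 < (1 + x) * exp x" using assms \<open>v < x\<close> by simp
  ultimately show "\<exists>y. ((\<lambda>x. x * exp x) has_real_derivative y) (at x) \<and> 0 < y" by blast
qed (auto intro!: continuous_intros)

lemma lambert_W_ex1:
  fixes x :: real
  assumes "x \<ge> - 1 / exp 1"
  shows "\<exists>!w. w \<ge> - 1 \<and> w * exp w = x"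
proof -
  have "\<exists>w. - 1 \<le> w \<and> w \<le> max 0 x \<and> w * exp w = x"
  proof (rule IVT'[of "\<lambda>w. w * exp w"])
    show "- 1 * exp (- 1) \<le> x" using assms by (simp add: exp_minus field_simps)
    show "x \<le> max 0 x * exp (max 0 x)"
      by (cases "x \<ge> 0") (auto simp: max_def mult_le_cancel_left1)
  qed (auto intro!: continuous_intros)
  then obtain w where w: "- 1 \<le> w" "w * exp w = x" by auto
  have "v = w" if "- 1 \<le> v \<and> v * exp v = x" for v
    using strict_mono_mult_exp[of v w] strict_mono_mult_exp[of w v] that w by linarith
  then show ?thesis using w by blast
qed

end

theory Submission
  imports Defs "HOL-Analysis.Derivative" "HOL-Real_Asymp.Real_Asymp"
begin

text \<open>
  Feeding a unit residual into the \<open>l\<close>-th inner step of the \<open>m\<close>-th row leaves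
  \<open>(1 + z/m)\<^sup>m\<^sup>-\<^sup>l\<close> as the only nonzero entry of the first column. The extrapolation
  tableau is a scaled iterated difference operator: its \<open>(k+1)\<close>-st column is the \<open>k\<close>-th backward
  difference of \<open>n\<^sup>k T\<^sub>n\<^sub>,\<^sub>1\<close> divided by \<open>k!\<close>. Hence (\<open>norm_ee_Q\<close>)
  the internal stability polynomial has modulus
  \<open>m\<^sup>p / (m! (p - m)!) * \<bar>1 + z/m\<bar>\<^sup>m\<^sup>-\<^sup>l\<close>.

  Let \<open>w = W(1/e)\<close>, so that \<open>w e\<^sup>1\<^sup>+\<^sup>w = 1\<close>. The weight is at most \<open>w\<^sup>-\<^sup>p\<close>, with no
  polynomial factor (\<open>extrapolation_weight_le\<close>): apply \<open>x\<^sup>n/n! \<le> e\<^sup>x\<close> to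
  \<open>m\<^sup>m/m!\<close> and to \<open>(w m)\<^sup>p\<^sup>-\<^sup>m/(p - m)!\<close>. In the left half-plane
  \<open>\<bar>1 + z/m\<bar>\<^sup>2 \<le> 1 + \<bar>z\<bar>\<^sup>2/m\<^sup>2 \<le> exp (\<bar>z\<bar>/m)\<close>, so the other factor is at most
  \<open>exp (\<bar>z\<bar>/2)\<close> for every \<open>m\<close> and \<open>l\<close> (\<open>euler_factor_le\<close>).

  It remains to see that the stability region is not too large
  (\<open>stab_region_left_half_plane_bound\<close>): for each \<open>c > 1/e\<close> its part in the left half-plane
  eventually lies in the disc of radius \<open>c p\<close>. On that part both the exponential and its Taylor polynomial
  are bounded by one, whereas the Taylor remainder is about \<open>z\<^sup>p\<^sup>+\<^sup>1 / (p! (p + 1 - z))\<close>,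
  which by Stirling would grow at least like \<open>(c e)\<^sup>p\<close> up to polynomial factors if
  \<open>\<bar>z\<bar> > c p\<close>.

  With \<open>c = 1/2\<close> the maximum is at most \<open>w\<^sup>-\<^sup>p exp (p/4)\<close>. Since
  \<open>exp (1/4) < 1 + 1/e\<close>, this beats the claimed bound by an exponential factor, which absorbs the
  denominator of order \<open>\<surd>p\<close>.
\<close>

section \<open>The internal stability polynomials in closed form\<close>

lemma ee_Y_unit:
  assumes "1 \<le> l"
  shows "ee_Y z 0 (\<lambda>i j. if i = m \<and> j = l then 1 else 0) i n =
    (if i = m \<and> l \<le> n then (1 + z / of_nat m) ^ (n - l) else 0)"
proof (induction n)
  case 0
  then show ?case using assms by simp
next
  case (Suc n)
  then show ?case by (auto simp: Suc_diff_le le_Suc_eq)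
qed

text \<open>
  One step of the extrapolation recursion, stripped of powers and factorials: the index \<open>i = j - m\<close>
  measures how far the perturbed row lies above row \<open>j\<close>. The case distinction stands for the
  binomial coefficient with lower index \<open>-1\<close>.
\<close>

lemma weighted_pascal:
  fixes j i k :: nat
  assumes "i \<le> j"
  shows "(of_nat j :: 'a::comm_ring_1) * of_nat (k choose i)
      + (of_nat j - of_nat (Suc k)) * (if i = 0 then 0 else of_nat (k choose (i - 1)))
    = of_nat (j - i) * of_nat (Suc k choose i)"
proof (cases i)
  case 0
  then show ?thesis by simp
next
  case (Suc i')
  have "Suc i' * (Suc k choose Suc i') = Suc k * (k choose i')"
    by (rule Suc_times_binomial)
  then have "(of_nat (Suc i') :: 'a) * (of_nat (k choose i') + of_nat (k choose Suc i'))
      = of_nat (Suc k) * of_nat (k choose i')"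
    by (simp only: binomial_Suc_Suc of_nat_add[symmetric] of_nat_mult[symmetric])
  then show ?thesis using assms unfolding Suc
    by (simp add: of_nat_diff algebra_simps)
qed

text \<open>
  Column \<open>k + 1\<close> of the tableau is the \<open>k\<close>-th backward difference of \<open>n\<^sup>k Y\<^sub>n\<close> over \<open>k!\<close>, where
  \<open>Y\<^sub>n\<close> is the first column; here only one entry \<open>Y\<^sub>m\<close> is nonzero. The binomial coefficient
  vanishes by itself when row \<open>m\<close> lies too far above row \<open>j\<close> to influence it.
\<close>

lemma ee_T_single:
  assumes "\<And>i. ee_Y z U r i i = (if i = m then y else 0)" and "Suc k \<le> j"
  shows "ee_T z U r j (Suc k) =
    (if m \<le> j then (-1) ^ (j - m) * of_nat (k choose (j - m)) * of_nat m ^ k * y / fact k else 0)"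
  using assms(2)
proof (induction k arbitrary: j)
  case 0
  then show ?case using assms(1)[of j] by (cases "j = m") (auto simp: binomial_eq_0)
next
  case (Suc k)
  define T where "T = ee_T z U r"
  have nz: "(of_nat j - of_nat (Suc k) :: complex) \<noteq> 0" "(of_nat (Suc k) :: complex) \<noteq> 0"
    using Suc.prems by (metis Suc_n_not_le_n of_nat_eq_iff right_minus_eq) (metis of_nat_eq_0_iff nat.distinct(1))
  have c: "of_nat j / (of_nat j - of_nat (Suc (Suc k)) + 1) - 1
      = (of_nat (Suc k) :: complex) / (of_nat j - of_nat (Suc k))"
  proof -
    have e: "(of_nat j - of_nat (Suc (Suc k)) + 1 :: complex) = of_nat j - of_nat (Suc k)" by simp
    have d: "x / d - 1 = (x - d) / d" if "d \<noteq> 0" for x d :: complex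
      using that by (simp add: diff_divide_distrib)
    show ?thesis unfolding e d[OF nz(1)] by (simp del: of_nat_Suc)
  qed
  have "T j (Suc (Suc k)) = T j (Suc k) + (T j (Suc k) - T (j - 1) (Suc k)) /
      (of_nat (Suc k) / (of_nat j - of_nat (Suc k)))"
    unfolding T_def ee_T.simps c ..
  also have "\<dots> = (of_nat j * T j (Suc k) - (of_nat j - of_nat (Suc k)) * T (j - 1) (Suc k))
      / of_nat (Suc k)"
    using nz by (simp add: divide_simps del: of_nat_Suc) (simp add: algebra_simps)
  finally have rec: "T j (Suc (Suc k)) = \<dots>" .
  have IH: "T j' (Suc k) = (if m \<le> j' then (-1) ^ (j' - m) * of_nat (k choose (j' - m))
      * of_nat m ^ k * y / fact k else 0)" if "j' = j \<or> j' = j - 1" for j'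
    unfolding T_def using Suc.IH[of j'] Suc.prems that by auto
  show ?case
  proof (cases "m \<le> j")
    case False
    then have "T j (Suc k) = 0" "T (j - 1) (Suc k) = 0" using IH by auto
    then show ?thesis unfolding T_def[symmetric] using rec False by simp
  next
    case True
    define i where "i = j - m"
    have i: "i \<le> j" "m = j - i" using True by (auto simp: i_def)
    have 1: "T (j - 1) (Suc k) = - ((-1) ^ i *
        (if i = 0 then 0 else of_nat (k choose (i - 1))) * of_nat m ^ k * y / fact k)"
    proof (cases i)
      case 0
      then show ?thesis using IH[of "j - 1"] i Suc.prems by auto
    next
      case (Suc i')
      then have "j - 1 - m = i'" "m \<le> j - 1" using i by auto
      then show ?thesis using IH[of "j - 1"] Suc by simp
    qed
    have 2: "T j (Suc k) = (-1) ^ i * of_nat (k choose i) * of_nat m ^ k * y / fact k"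
      using IH[of j] True by (simp add: i_def)
    have "of_nat j * T j (Suc k) - (of_nat j - of_nat (Suc k)) * T (j - 1) (Suc k)
       = (-1) ^ i * of_nat m ^ k * y / fact k * (of_nat j * of_nat (k choose i)
      + (of_nat j - of_nat (Suc k)) * (if i = 0 then 0 else of_nat (k choose (i - 1))))"
      unfolding 1 2 by (simp add: algebra_simps add_divide_distrib diff_divide_distrib)
    also have "\<dots> = (-1) ^ i * of_nat m ^ k * y / fact k * (of_nat m * of_nat (Suc k choose i))"
      unfolding weighted_pascal[OF i(1)] i(2)[symmetric] ..
    finally have "T j (Suc (Suc k)) = \<dots> / of_nat (Suc k)" using rec by simp
    then show ?thesis unfolding T_def[symmetric] using True
      by (simp add: i_def mult_ac del: binomial_Suc_Suc of_nat_Suc)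
  qed
qed

lemma poly_ee_Q:
  assumes "1 \<le> l" "l \<le> m" "m \<le> p"
  shows "poly (ee_Q p m l) z = (-1) ^ (p - m) * of_nat ((p - 1) choose (p - m))
    * of_nat m ^ (p - 1) * (1 + z / of_nat m) ^ (m - l) / fact (p - 1)"
proof -
  have p: "p \<ge> 1" "Suc (p - 1) = p" using assms by auto
  obtain P where "ee_repr (ee_step p) p P (ee_Q p)" using ee_Q_repr[OF p(1)] by blast
  from ee_repr_unique[OF this assms]
  have "poly (ee_Q p m l) z =
      ee_T z 0 (\<lambda>i j. if i = m \<and> j = l then 1 else 0) p (Suc (p - 1))"
    unfolding ee_step_def p(2) .
  also have "\<dots> = (if m \<le> p then (-1) ^ (p - m) * of_nat ((p - 1) choose (p - m))
    * of_nat m ^ (p - 1) * (1 + z / of_nat m) ^ (m - l) / fact (p - 1) else 0)"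
    by (rule ee_T_single) (use assms in \<open>auto simp: ee_Y_unit\<close>)
  finally show ?thesis using assms by simp
qed

lemma norm_ee_Q:
  assumes "1 \<le> l" "l \<le> m" "m \<le> p"
  shows "cmod (poly (ee_Q p m l) z) =
    real m ^ p / (fact m * fact (p - m)) * cmod (1 + z / of_nat m) ^ (m - l)"
proof -
  have "real ((p - 1) choose (p - m)) = fact (p - 1) / (fact (p - m) * fact (m - 1))"
  proof -
    have "p - m \<le> p - 1" "p - 1 - (p - m) = m - 1" using assms by auto
    then show ?thesis by (simp add: binomial_fact)
  qed
  moreover have "real m ^ p = real m * real m ^ (p - 1)" "fact m = real m * fact (m - 1)"
    using assms by (simp_all add: power_eq_if fact_reduce)
  ultimately show ?thesis using assms
    by (simp add: poly_ee_Q norm_mult norm_divide norm_power divide_simps mult_ac)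
qed

section \<open>Size of the internal stability polynomials\<close>

lemma power_div_fact_le_exp:
  fixes x :: real
  assumes "x \<ge> 0"
  shows "x ^ n / fact n \<le> exp x"
proof -
  obtain t where "exp x = (\<Sum>k<Suc n. x ^ k / fact k) + exp t / fact (Suc n) * x ^ Suc n"
    using Maclaurin_exp_le[of x "Suc n"] by blast
  moreover have "x ^ n / fact n \<le> (\<Sum>k<Suc n. x ^ k / fact k)"
    using assms by (simp add: sum_nonneg)
  moreover have "0 \<le> exp t / fact (Suc n) * x ^ Suc n" using assms by simp
  ultimately show ?thesis by linarith
qed

text \<open>
  The weight is a product of \<open>m\<^sup>m/m!\<close> and \<open>m\<^sup>p\<^sup>-\<^sup>m/(p - m)!\<close>. For any scale \<open>w\<close> the exponential
  series bounds the product by \<open>(w e\<^sup>1\<^sup>+\<^sup>w)\<^sup>m w\<^sup>-\<^sup>p\<close>; the Lambert equation is exactly the choice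
  of \<open>w\<close> that removes the dependence on \<open>m\<close>.
\<close>

lemma extrapolation_weight_le:
  fixes w :: real
  assumes "w > 0" "w * exp w = 1 / exp 1" "m \<le> p"
  shows "real m ^ p / (fact m * fact (p - m)) \<le> (1 / w) ^ p"
proof -
  have "real m ^ m / fact m \<le> exp (real m)"
    by (rule power_div_fact_le_exp) simp
  moreover have "(w * real m) ^ (p - m) / fact (p - m) \<le> exp (w * real m)"
    by (rule power_div_fact_le_exp) (use assms in simp)
  ultimately have "(real m ^ m / fact m) * ((w * real m) ^ (p - m) / fact (p - m))
      \<le> exp (real m) * exp (w * real m)"
    using assms(1) by (intro mult_mono) auto
  then have "w ^ m * ((real m ^ m / fact m) * ((w * real m) ^ (p - m) / fact (p - m)))
      \<le> w ^ m * (exp (real m) * exp (w * real m))"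
    using assms(1) by (intro mult_left_mono) auto
  moreover have "w ^ m * ((real m ^ m / fact m) * ((w * real m) ^ (p - m) / fact (p - m)))
      = w ^ p * (real m ^ p / (fact m * fact (p - m)))"
  proof -
    have "x ^ p = x ^ m * x ^ (p - m)" for x :: real
      using assms(3) by (simp flip: power_add)
    then show ?thesis by (simp add: power_mult_distrib)
  qed
  moreover have "w ^ m * (exp (real m) * exp (w * real m)) = 1"
  proof -
    have "w ^ m * (exp (real m) * exp (w * real m)) = (w * exp w * exp 1) ^ m"
      by (simp add: power_mult_distrib exp_of_nat_mult[symmetric] mult_ac)
    then show ?thesis using assms(2) by simp
  qed
  ultimately show ?thesis using assms(1) by (simp add: power_divide field_simps)
qed

lemma one_plus_square_le_exp:
  fixes s :: real
  assumes "s \<ge> 0"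
  shows "1 + s\<^sup>2 \<le> exp s"
proof -
  obtain t where t: "exp s = (\<Sum>k<4. s ^ k / fact k) + exp t / fact 4 * s ^ 4"
    using Maclaurin_exp_le[of s 4] by blast
  have "0 \<le> exp t / fact 4 * s ^ 4" using assms by simp
  moreover have "(\<Sum>k<4. s ^ k / fact k) = 1 + s + s\<^sup>2 / 2 + s ^ 3 / 6"
    by (simp add: numeral_eq_Suc)
  \<comment> \<open>complete the square in \<open>s\<^sup>2 - 3 s + 6\<close>\<close>
  moreover have "0 \<le> s * ((s - 3 / 2)\<^sup>2 + 15 / 4)" using assms by simp
  then have "s\<^sup>2 \<le> s + s\<^sup>2 / 2 + s ^ 3 / 6"
    by (simp add: power2_eq_square power3_eq_cube algebra_simps)
  ultimately show ?thesis using t by linarith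
qed

text \<open>
  In the left half-plane the cross term \<open>2 Re u\<close> of \<open>\<bar>1 + u\<bar>\<^sup>2\<close> has the favourable sign. Replacing
  \<open>1 + \<bar>u\<bar>\<^sup>2\<close> by \<open>exp \<bar>u\<bar>\<close> yields a bound that is uniform in \<open>m\<close>, small \<open>m\<close> included.
\<close>

lemma euler_factor_le:
  assumes "Re z \<le> 0" "k \<le> m"
  shows "cmod (1 + z / of_nat m) ^ k \<le> exp (cmod z / 2)"
proof (cases "m = 0")
  case True
  then show ?thesis using assms by simp
next
  case False
  define u where "u = z / of_nat m"
  have Re: "Re u \<le> 0" using assms by (simp add: u_def divide_nonpos_nonneg)
  have "(cmod (1 + u))\<^sup>2 = 1 + 2 * Re u + (cmod u)\<^sup>2"
    unfolding cmod_power2 by (simp add: power2_eq_square algebra_simps)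
  also have "\<dots> \<le> 1 + (cmod u)\<^sup>2" using Re by simp
  also have "\<dots> \<le> exp (cmod u)" by (rule one_plus_square_le_exp) simp
  also have "\<dots> = (exp (cmod u / 2))\<^sup>2" by (simp flip: exp_double)
  finally have "cmod (1 + u) \<le> exp (cmod u / 2)"
    by (rule power2_le_imp_le) simp
  then have "cmod (1 + u) ^ k \<le> exp (cmod u / 2) ^ k"
    by (intro power_mono) auto
  also have "\<dots> \<le> exp (cmod u / 2) ^ m"
    using assms by (intro power_increasing) auto
  also have "\<dots> = exp (cmod z / 2)"
    using False by (simp add: u_def norm_divide flip: exp_of_nat_mult)
  finally show ?thesis by (simp add: u_def)
qed

section \<open>The stability region in the left half-plane\<close>

lemma has_field_derivative_power_times_exp:
  fixes z :: complex
  shows "((\<lambda>s. (1 - s) ^ Suc p * exp (s * z)) has_field_derivative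
    (exp (s * z) * z * (1 - s) ^ Suc p - of_nat (Suc p) * (1 - s) ^ p * exp (s * z))) (at s)"
  by (rule derivative_eq_intros refl | simp)+

lemma has_field_derivative_exp_sum:
  fixes z :: complex
  shows "((\<lambda>s. exp (s * z) * (\<Sum>k\<le>p. ((1 - s) * z) ^ k / fact k))
    has_field_derivative (z ^ Suc p / fact p * (1 - s) ^ p * exp (s * z))) (at s)"
proof (induction p)
  case 0
  show ?case by (auto intro!: derivative_eq_intros)
next
  case (Suc p)
  define c where "c = z ^ Suc p / fact (Suc p)"
  have c: "z ^ Suc p / fact p = c * of_nat (Suc p)" "z ^ Suc (Suc p) / fact (Suc p) = z * c"
    by (simp_all add: c_def del: of_nat_Suc)
  have "z ^ Suc p / fact p * (1 - s) ^ p * exp (s * z)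
      + c * (exp (s * z) * z * (1 - s) ^ Suc p - of_nat (Suc p) * (1 - s) ^ p * exp (s * z))
      = z ^ Suc (Suc p) / fact (Suc p) * (1 - s) ^ Suc p * exp (s * z)"
    unfolding c by (simp only: right_diff_distrib mult_ac) simp
  moreover have "exp (x * z) * (\<Sum>k\<le>p. ((1 - x) * z) ^ k / fact k) + c * ((1 - x) ^ Suc p * exp (x * z))
      = exp (x * z) * (\<Sum>k\<le>Suc p. ((1 - x) * z) ^ k / fact k)" for x
  proof -
    have "((1 - x) * z) ^ Suc p / fact (Suc p) = c * (1 - x) ^ Suc p"
      unfolding c_def power_mult_distrib by (simp del: power_Suc fact_Suc)
    then show ?thesis by (simp only: sum.atMost_Suc distrib_left mult_ac)
  qed
  ultimately show ?case
    using DERIV_add[OF Suc DERIV_cmult[OF has_field_derivative_power_times_exp[of p z], of c]]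
    by (simp only:)
qed

text \<open>
  With \<open>J = \<integral>\<^sub>0\<^sup>1 (1 - t)\<^sup>p exp (t z) dt\<close> the Taylor remainder is \<open>z\<^sup>p\<^sup>+\<^sup>1 J / p!\<close>. Integrating the
  derivative of \<open>(1 - t)\<^sup>p\<^sup>+\<^sup>1 exp (t z)\<close> gives
  \<open>(p + 1 - z) J = 1 - z \<integral>\<^sub>0\<^sup>1 t (1 - t)\<^sup>p exp (t z) dt\<close>, and for \<open>Re z \<le> 0\<close> the last
  integral is at most \<open>1 / ((p + 1) (p + 2))\<close>, so \<open>J\<close> is close to \<open>1 / (p + 1 - z)\<close>. The function
  \<open>H\<close> below is the combination of the two antiderivatives in which the main terms cancel; the mean
  value inequality, with majorant \<open>\<phi>\<close>, then replaces the integrals.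
\<close>

lemma exp_remainder_lower_bound:
  assumes "Re z \<le> 0"
  shows "cmod z ^ Suc p / fact p * (1 - cmod z / ((real p + 1) * (real p + 2)))
    \<le> cmod (z - of_nat (Suc p)) * cmod (exp z - (\<Sum>k\<le>p. z ^ k / fact k))"
proof -
  define a where "a = z ^ Suc p / fact p"
  define b where "b = z - of_nat (Suc p)"
  define S where "S = (\<Sum>k\<le>p. z ^ k / fact k)"
  define H where "H = (\<lambda>s. a * ((1 - s) ^ Suc p * exp (s * z))
    - b * (exp (s * z) * (\<Sum>k\<le>p. ((1 - s) * z) ^ k / fact k)))"
  define H' where "H' = (\<lambda>s. - (a * z * s * (1 - s) ^ p * exp (s * z)))"
  define \<phi> where "\<phi> = (\<lambda>t::real. cmod (a * z)
    * ((1 - t) ^ Suc (Suc p) / (real p + 2) - (1 - t) ^ Suc p / (real p + 1)))"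
  have H': "(H has_field_derivative H' s) (at s)" for s
  proof -
    from DERIV_diff[OF DERIV_cmult[OF has_field_derivative_power_times_exp, of a] DERIV_cmult[OF has_field_derivative_exp_sum, of b]]
    have "(H has_field_derivative
        (a * (exp (s * z) * z * (1 - s) ^ Suc p - of_nat (Suc p) * (1 - s) ^ p * exp (s * z))
         - b * (a * (1 - s) ^ p * exp (s * z)))) (at s)"
      by (simp add: H_def a_def)
    moreover have "a * (exp (s * z) * z * (1 - s) ^ Suc p - of_nat (Suc p) * (1 - s) ^ p * exp (s * z))
         - b * (a * (1 - s) ^ p * exp (s * z)) = H' s"
      by (simp add: H'_def b_def algebra_simps)
    ultimately show ?thesis by simp
  qed
  have \<phi>': "(\<phi> has_field_derivative cmod (a * z) * (t * (1 - t) ^ p)) (at t)" for t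
  proof -
    have "(\<phi> has_field_derivative cmod (a * z)
        * (real (Suc (Suc p)) * (1 - t) ^ Suc p * (- 1) / (real p + 2)
          - real (Suc p) * (1 - t) ^ p * (- 1) / (real p + 1))) (at t)"
      unfolding \<phi>_def by (rule derivative_eq_intros refl | simp)+
    moreover have "real (Suc (Suc p)) * (1 - t) ^ Suc p * (- 1) / (real p + 2)
          - real (Suc p) * (1 - t) ^ p * (- 1) / (real p + 1) = t * (1 - t) ^ p"
    proof -
      have "real (Suc (Suc p)) / (real p + 2) = 1" "real (Suc p) / (real p + 1) = 1" by auto
      then show ?thesis by (simp add: divide_simps) (simp add: algebra_simps)
    qed
    ultimately show ?thesis by simp
  qed
  have "norm (H (of_real 1) - H (of_real 0)) \<le> \<phi> 1 - \<phi> 0"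
  proof (rule differentiable_bound_general[where f = "\<lambda>t. H (of_real t)"])
    show "continuous_on {0..1} (\<lambda>t. H (of_real t))"
      unfolding H_def by (intro continuous_intros) auto
    show "continuous_on {0..1} \<phi>"
      unfolding \<phi>_def by (intro continuous_intros) auto
    show "((\<lambda>t. H (of_real t)) has_vector_derivative H' (of_real t)) (at t)" for t
      by (rule has_vector_derivative_real_field) (rule H')
    show "(\<phi> has_vector_derivative cmod (a * z) * (t * (1 - t) ^ p)) (at t)" for t
      using \<phi>'[of t] by (simp add: has_real_derivative_iff_has_vector_derivative)
    show "norm (H' (of_real t)) \<le> cmod (a * z) * (t * (1 - t) ^ p)" if "0 < t" "t < 1" for t
    proof -
      have "cmod (1 - of_real t) = 1 - t"
        using that by (metis abs_of_pos diff_gt_0_iff_gt norm_of_real of_real_1 of_real_diff)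
      then have "norm (H' (of_real t)) = cmod (a * z) * (t * (1 - t) ^ p) * exp (t * Re z)"
        using that by (simp add: H'_def norm_mult norm_power)
      also have "\<dots> \<le> cmod (a * z) * (t * (1 - t) ^ p) * 1"
        using that assms by (intro mult_left_mono) (auto simp: mult_nonneg_nonpos)
      finally show ?thesis by simp
    qed
  qed auto
  moreover have "H (of_real 1) - H (of_real 0) = - (b * (exp z - S)) - a"
  proof -
    have "(\<Sum>k\<le>p. (0::complex) ^ k / fact k) = 1" by (induction p) auto
    then show ?thesis by (simp add: H_def S_def algebra_simps)
  qed
  moreover have "\<phi> 1 - \<phi> 0 = cmod (a * z) / ((real p + 1) * (real p + 2))"
    by (simp add: \<phi>_def divide_simps)
  ultimately have "cmod (- (b * (exp z - S)) - a) \<le> cmod (a * z) / ((real p + 1) * (real p + 2))"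
    by simp
  moreover have "cmod a \<le> cmod (b * (exp z - S)) + cmod (- (b * (exp z - S)) - a)"
    using norm_triangle_ineq4[of "- (b * (exp z - S))" "- (b * (exp z - S)) - a"] by simp
  ultimately have "cmod a \<le> cmod b * cmod (exp z - S)
      + cmod a * (cmod z / ((real p + 1) * (real p + 2)))"
    by (simp add: norm_mult)
  then have "cmod a * (1 - cmod z / ((real p + 1) * (real p + 2))) \<le> cmod b * cmod (exp z - S)"
    by (simp add: right_diff_distrib)
  then show ?thesis by (simp add: a_def b_def S_def norm_divide norm_power norm_mult)
qed

lemma exp_sum_le_last_term:
  fixes x :: real
  assumes "4 * real p \<le> x" "x > 0"
  shows "(\<Sum>k<p. x ^ k / fact k) \<le> x ^ p / fact p / 3"
  using assms(1)
proof (induction p)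
  case 0
  show ?case by simp
next
  case (Suc p)
  have "(\<Sum>k<Suc p. x ^ k / fact k) \<le> 4 / 3 * (x ^ p / fact p)"
    using Suc by simp
  also have "\<dots> = (4 * real (Suc p)) * (x ^ p / fact (Suc p)) / 3"
    by (simp add: fact_Suc del: of_nat_Suc)
  also have "\<dots> \<le> x * (x ^ p / fact (Suc p)) / 3"
    using Suc.prems assms(2) by (intro divide_right_mono mult_right_mono) auto
  finally show ?case by simp
qed

text \<open>
  A crude a priori bound: beyond \<open>4 p\<close> the leading term of the Taylor polynomial outweighs all the
  others. It confines attention to arguments of size \<open>O(p)\<close>, for which the correction
  \<open>\<bar>z\<bar> / ((p + 1) (p + 2))\<close> in the remainder bound is harmless.
\<close>

lemma stab_region_norm_less:
  assumes "p \<ge> 1" "z \<in> stab_region p"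
  shows "cmod z < 4 * real p"
proof (rule ccontr)
  define t where "t = cmod z ^ p / fact p"
  define s where "s = (\<Sum>k<p. cmod z ^ k / fact k)"
  assume "\<not> ?thesis"
  then have s: "s \<le> t / 3"
    unfolding s_def t_def using assms(1) by (intro exp_sum_le_last_term) auto
  have "(\<Sum>k\<in>{0}. cmod z ^ k / fact k) \<le> s"
    unfolding s_def using assms(1) by (intro sum_mono2) auto
  then have "1 \<le> s" by simp
  have "(\<Sum>k=0..p. z ^ k / fact k) = (\<Sum>k<p. z ^ k / fact k) + z ^ p / fact p"
    by (simp add: atLeast0AtMost flip: lessThan_Suc_atMost)
  then have "cmod ((\<Sum>k<p. z ^ k / fact k) + z ^ p / fact p) \<le> 1"
    using assms(2) by (simp add: stab_region_def)
  moreover have "cmod (\<Sum>k<p. z ^ k / fact k) \<le> s"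
    unfolding s_def by (rule sum_norm_le) (simp add: norm_divide norm_power)
  moreover have "cmod (z ^ p / fact p) = t" by (simp add: t_def norm_divide norm_power)
  ultimately have "t \<le> s + 1"
    using norm_triangle_ineq4[of "(\<Sum>k<p. z ^ k / fact k) + z ^ p / fact p" "\<Sum>k<p. z ^ k / fact k"]
    by simp
  then show False using s \<open>1 \<le> s\<close> by linarith
qed

lemma fact_le_stirling:
  assumes "n \<ge> 1"
  shows "fact n \<le> exp 1 * real n * (real n / exp 1) ^ n"
  using assms
proof (induction n rule: dec_induct)
  case base
  show ?case by simp
next
  case (step n)
  \<comment> \<open>the induction step amounts to \<open>e \<le> (1 + 1/n)\<^sup>n\<^sup>+\<^sup>1\<close>\<close>
  have "1 + - (1 / real (Suc n)) \<le> exp (- (1 / real (Suc n)))"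
    by (rule exp_ge_add_one_self)
  also have "1 + - (1 / real (Suc n)) = real n / real (Suc n)" by (simp add: field_simps)
  finally have "(real n / real (Suc n)) ^ Suc n \<le> exp (- (1 / real (Suc n))) ^ Suc n"
    by (intro power_mono) auto
  also have "\<dots> = exp (- 1)"
    by (simp del: of_nat_Suc power_Suc flip: exp_of_nat_mult)
  finally have "real n ^ Suc n / real (Suc n) ^ Suc n \<le> 1 / exp 1"
    unfolding power_divide by (simp add: exp_minus inverse_eq_divide)
  then have *: "real n ^ Suc n \<le> real (Suc n) ^ Suc n / exp 1"
    by (simp add: divide_simps del: of_nat_Suc power_Suc)
  have "fact (Suc n) = real (Suc n) * fact n" by simp
  also have "\<dots> \<le> real (Suc n) * (exp 1 * real n * (real n / exp 1) ^ n)"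
    using step by (intro mult_left_mono) auto
  also have "\<dots> = exp 1 * real (Suc n) * (real n ^ Suc n / exp 1 ^ n)"
    by (simp add: power_divide del: of_nat_Suc)
  also have "\<dots> \<le> exp 1 * real (Suc n) * ((real (Suc n) ^ Suc n / exp 1) / exp 1 ^ n)"
    using * by (intro mult_left_mono divide_right_mono) auto
  also have "\<dots> = exp 1 * real (Suc n) * (real (Suc n) / exp 1) ^ Suc n"
    by (simp add: power_divide del: of_nat_Suc)
  finally show ?case .
qed

text \<open>
  The threshold \<open>1/e\<close> is the reciprocal of the growth rate of \<open>p\<^sup>p/p!\<close>. On the stability region
  in the left half-plane the remainder has modulus at most \<open>2\<close>; if also \<open>c p < \<bar>z\<bar>\<close>, its lower
  bound forces \<open>(c e)\<^sup>p \<le> 84 p\<close>, which fails for large \<open>p\<close> because \<open>c e > 1\<close>.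
\<close>

lemma stab_region_left_half_plane_bound:
  fixes c :: real
  assumes "c > 1 / exp 1"
  shows "\<forall>\<^sub>F p in sequentially. \<forall>z \<in> stab_region p \<inter> left_half_plane. cmod z \<le> c * real p"
proof -
  define a where "a = c * exp 1"
  have a: "a > 1" "c > 0"
    using assms order_less_trans[of 0 "1 / exp 1" c] by (auto simp: a_def field_simps)
  have "\<forall>\<^sub>F p in sequentially. 84 * real p < a ^ p" using a(1) by real_asymp
  then show ?thesis using eventually_ge_at_top[of 8]
  proof eventually_elim
    case (elim p)
    show ?case
    proof (intro ballI, rule ccontr)
      fix z assume z: "z \<in> stab_region p \<inter> left_half_plane" and "\<not> cmod z \<le> c * real p"
      then have large: "c * real p < cmod z" by simp
      have pos: "0 < cmod z" by (rule order.strict_trans1[OF _ large]) (use a in simp)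
      have Re: "Re z \<le> 0" using z by (simp add: left_half_plane_def)
      have "cmod z < 4 * real p" using z elim by (intro stab_region_norm_less) auto
      also have "\<dots> \<le> (real p + 1) * (real p + 2) / 2"
      proof -
        have "8 * real p \<le> real p * real p" using elim by (intro mult_right_mono) auto
        then show ?thesis by (simp add: algebra_simps)
      qed
      finally have "cmod z / ((real p + 1) * (real p + 2)) \<le> 1 / 2"
        by (subst pos_divide_le_eq) auto
      then have "1 / 2 \<le> 1 - cmod z / ((real p + 1) * (real p + 2))" by simp
      then have "cmod z ^ Suc p / fact p * (1 / 2)
          \<le> cmod z ^ Suc p / fact p * (1 - cmod z / ((real p + 1) * (real p + 2)))"
        by (intro mult_left_mono) auto
      also have "\<dots> \<le> cmod (z - of_nat (Suc p)) * cmod (exp z - (\<Sum>k\<le>p. z ^ k / fact k))"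
        by (rule exp_remainder_lower_bound[OF Re])
      also have "\<dots> \<le> (7 * cmod z) * 2"
      proof (intro mult_mono)
        have "exp 1 * (real p / exp 1) \<le> 3 * (real p / exp 1)"
          using exp_le by (intro mult_right_mono) auto
        moreover have "1 / exp 1 * real p \<le> c * real p"
          using assms by (intro mult_right_mono) auto
        ultimately have "real p \<le> 3 * cmod z" using large by simp
        then have "real (Suc p) \<le> 6 * cmod z" using elim by simp
        then show "cmod (z - of_nat (Suc p)) \<le> 7 * cmod z"
          using norm_triangle_ineq4[of z "of_nat (Suc p)"] by (simp only: norm_of_nat)
        have "cmod (\<Sum>k\<le>p. z ^ k / fact k) \<le> 1"
          using z by (simp add: stab_region_def atLeast0AtMost)
        moreover have "cmod (exp z) \<le> 1" using Re by simp
        ultimately show "cmod (exp z - (\<Sum>k\<le>p. z ^ k / fact k)) \<le> 2"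
          using norm_triangle_ineq4[of "exp z" "\<Sum>k\<le>p. z ^ k / fact k"] by linarith
      qed auto
      finally have "cmod z ^ p \<le> 28 * fact p"
        using pos by (simp add: field_simps)
      also have "\<dots> \<le> 28 * (exp 1 * real p * (real p / exp 1) ^ p)"
        using elim by (intro mult_left_mono fact_le_stirling) auto
      also have "\<dots> \<le> 28 * (3 * real p * (real p / exp 1) ^ p)"
        using exp_le by (intro mult_left_mono mult_right_mono) auto
      finally have "cmod z ^ p \<le> 84 * real p * (real p / exp 1) ^ p" by simp
      moreover have "(c * real p) ^ p \<le> cmod z ^ p"
        using large a by (intro power_mono) auto
      moreover have "(c * real p) ^ p = a ^ p * (real p / exp 1) ^ p"
        by (simp add: a_def flip: power_mult_distrib)
      ultimately have "a ^ p * (real p / exp 1) ^ p \<le> 84 * real p * (real p / exp 1) ^ p"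
        by linarith
      moreover have "(real p / exp 1) ^ p > 0" using elim by simp
      ultimately show False using elim by simp
    qed
  qed
qed

section \<open>Numerical bounds and the growth of the maximum\<close>

text \<open>
  The Lagrange remainder is nonnegative also at negative arguments, where the inequality turns into
  an upper bound for the exponential at positive ones.
\<close>

lemma even_taylor_le_exp:
  fixes x :: real
  assumes "even n"
  shows "(\<Sum>k<n. x ^ k / fact k) \<le> exp x"
proof -
  obtain t where "exp x = (\<Sum>k<n. x ^ k / fact k) + exp t / fact n * x ^ n"
    using Maclaurin_exp_le[of x n] by blast
  moreover have "0 \<le> exp t / fact n * x ^ n"
    using assms by (intro mult_nonneg_nonneg) (auto simp: zero_le_even_power)
  ultimately show ?thesis by linarith
qed

lemma inverse_exp_1_bounds: "0.36 \<le> 1 / exp (1::real)" "1 / exp (1::real) \<le> 0.3682"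
proof -
  have even: "even (6::nat)" by simp
  have "(2.7166::real) \<le> exp 1"
    by (rule order_trans[OF _ even_taylor_le_exp[OF even]]) (auto simp: numeral_eq_Suc)
  then show "1 / exp (1::real) \<le> 0.3682" by (simp add: field_simps)
  have "(0.36::real) \<le> exp (- 1)"
    by (rule order_trans[OF _ even_taylor_le_exp[OF even]]) (auto simp: numeral_eq_Suc)
  then show "0.36 \<le> 1 / exp (1::real)" by (simp add: exp_minus field_simps)
qed

text \<open>
  The numerical bound has to be sharp: \<open>(1 + 1/e)/w < 4.92\<close> requires \<open>w > 0.27802\<close>, whereas
  \<open>W(1/e)\<close> is about \<open>0.27846\<close>.
\<close>

lemma lambert_W_inverse_e:
  defines "w \<equiv> lambert_W (1 / exp 1)"
  shows "w * exp w = 1 / exp 1" "w > 0.2781"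
proof -
  have "- 1 / exp 1 \<le> 1 / exp (1::real)" by simp
  from theI'[OF lambert_W_ex1[OF this]]
  have w: "w \<ge> - 1" "w * exp w = 1 / exp 1" by (auto simp: w_def lambert_W_def)
  then show "w * exp w = 1 / exp 1" by simp
  \<comment> \<open>\<open>v e\<^sup>v < 1/e\<close> for \<open>v = 0.2781\<close> is equivalent to \<open>v < exp (- 1 - v)\<close>\<close>
  have even: "even (10::nat)" by simp
  have "(0.2781::real) < exp (- 1.2781)"
    by (rule order.strict_trans2[OF _ even_taylor_le_exp[OF even]]) (auto simp: numeral_eq_Suc)
  then have "0.2781 * exp (0.2781::real) < exp (- 1.2781) * exp 0.2781" by simp
  also have "\<dots> = exp (- 1)" by (simp flip: exp_add)
  also have "\<dots> = 1 / exp 1" by (simp add: exp_minus inverse_eq_divide)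
  finally have less: "0.2781 * exp (0.2781::real) < w * exp w" using w by simp
  show "w > 0.2781"
  proof (rule ccontr)
    assume "\<not> ?thesis"
    then consider "w < 0.2781" | "w = 0.2781" by linarith
    then show False
      using strict_mono_mult_exp[of w "0.2781"] w(1) less by cases auto
  qed
qed

lemma ee_M_le:
  assumes "p \<ge> 1" "\<And>z. z \<in> S \<Longrightarrow> Re z \<le> 0" "\<And>z. z \<in> S \<Longrightarrow> cmod z \<le> R"
  shows "ee_M p S \<le> ereal ((1 / lambert_W (1 / exp 1)) ^ p * exp (R / 2))"
proof -
  have *: "cmod (poly (ee_Q p m l) z) \<le> (1 / lambert_W (1 / exp 1)) ^ p * exp (R / 2)"
    if "m \<in> {1..p}" "l \<in> {1..m}" "z \<in> S" for m l z
  proof -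
    have "real m ^ p / (fact m * fact (p - m)) \<le> (1 / lambert_W (1 / exp 1)) ^ p"
      using that lambert_W_inverse_e by (intro extrapolation_weight_le) auto
    moreover have "cmod (1 + z / of_nat m) ^ (m - l) \<le> exp (R / 2)"
      using euler_factor_le[of z "m - l" m] assms(2,3)[OF that(3)]
      by (meson diff_le_self divide_right_mono dual_order.trans exp_le_cancel_iff zero_le_numeral)
    ultimately have "real m ^ p / (fact m * fact (p - m)) * cmod (1 + z / of_nat m) ^ (m - l)
        \<le> (1 / lambert_W (1 / exp 1)) ^ p * exp (R / 2)"
      by (rule mult_mono) (use lambert_W_inverse_e(2) in auto)
    then show ?thesis using that by (simp add: norm_ee_Q)
  qed
  then show ?thesis unfolding ee_M_def
    using assms(1) by (auto intro!: Max.boundedI SUP_least)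
qed

theorem theorem4p15:
  fixes \<epsilon> :: real
  assumes "\<epsilon> > 0"
  shows "\<exists>p0::nat. p0 > 0 \<and> (\<forall>p\<ge>p0.
    ee_M p (stab_region p \<inter> left_half_plane)
      \<le> ereal (((1 + 1 / exp 1 + \<epsilon>) / lambert_W (1 / exp 1)) ^ p
               / ((2 + 2 / exp 1 + 2 * \<epsilon>) * pi * sqrt (real p - 1))) \<and>
    ((1 + 1 / exp 1 + \<epsilon>) / lambert_W (1 / exp 1)) ^ p
        / ((2 + 2 / exp 1 + 2 * \<epsilon>) * pi * sqrt (real p - 1))
      < (4.92 + 3.6 * \<epsilon>) ^ p
        / ((2 + 2 / exp 1 + 2 * \<epsilon>) * pi * sqrt (real p - 1)))"
proof -
  define w where "w = lambert_W (1 / exp 1)"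
  define A where "A = 1 + 1 / exp 1 + \<epsilon>"
  define B where "B = (2 + 2 / exp 1 + 2 * \<epsilon>) * pi"
  have w: "w > 0.2781" using lambert_W_inverse_e by (simp add: w_def)
  have A: "A > 1.36" using inverse_exp_1_bounds(1) assms by (simp add: A_def)
  have B: "B > 0" unfolding B_def using assms by (intro mult_pos_pos add_pos_pos) auto
  \<comment> \<open>the exponential gain: \<open>exp (1/4)\<close> comes from \<open>exp (\<bar>z\<bar>/2)\<close> with \<open>\<bar>z\<bar> \<le> p/2\<close>\<close>
  define a where "a = A / exp (1 / 4)"
  have "exp (1 / 4) < A"
    using exp_bound[of "1 / 4"] A by (simp add: power2_eq_square)
  then have "a > 1" by (simp add: a_def)
  then have "\<forall>\<^sub>F p in sequentially. B * sqrt (real p - 1) \<le> a ^ p"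
    using B by real_asymp
  moreover have "1 / exp 1 < (1 / 2 :: real)"
    by (rule order.strict_trans1[OF inverse_exp_1_bounds(2)]) simp
  then have "\<forall>\<^sub>F p in sequentially.
      \<forall>z \<in> stab_region p \<inter> left_half_plane. cmod z \<le> 1 / 2 * real p"
    by (rule stab_region_left_half_plane_bound)
  ultimately have "\<forall>\<^sub>F p in sequentially.
    ee_M p (stab_region p \<inter> left_half_plane) \<le> ereal ((A / w) ^ p / (B * sqrt (real p - 1))) \<and>
    (A / w) ^ p / (B * sqrt (real p - 1)) < (4.92 + 3.6 * \<epsilon>) ^ p / (B * sqrt (real p - 1))"
    using eventually_ge_at_top[of 2]
  proof eventually_elim
    case (elim p)
    have D: "B * sqrt (real p - 1) > 0" using elim B by simp
    have "ee_M p (stab_region p \<inter> left_half_plane) \<le> ereal ((1 / w) ^ p * exp (1 / 2 * real p / 2))"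
      unfolding w_def using elim by (intro ee_M_le) (auto simp: left_half_plane_def)
    also have "(1 / w) ^ p * exp (1 / 2 * real p / 2) \<le> (A / w) ^ p / (B * sqrt (real p - 1))"
    proof -
      have "exp (1 / 2 * real p / 2) = exp (1 / 4) ^ p" by (simp flip: exp_of_nat_mult)
      also have "\<dots> \<le> A ^ p / (B * sqrt (real p - 1))"
        using elim(1) D by (simp add: a_def power_divide field_simps)
      finally have "(1 / w) ^ p * exp (1 / 2 * real p / 2) \<le> (1 / w) ^ p * (A ^ p / (B * sqrt (real p - 1)))"
        using w by (intro mult_left_mono) auto
      then show ?thesis by (simp add: power_divide)
    qed
    finally have 1: "ee_M p (stab_region p \<inter> left_half_plane)
        \<le> ereal ((A / w) ^ p / (B * sqrt (real p - 1)))" by simp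
    have "A < (4.92 + 3.6 * \<epsilon>) * 0.2781"
      using inverse_exp_1_bounds(2) assms by (simp add: A_def algebra_simps)
    also have "\<dots> \<le> (4.92 + 3.6 * \<epsilon>) * w" using w assms by (intro mult_left_mono) auto
    finally have "A / w < 4.92 + 3.6 * \<epsilon>" using w by (simp add: field_simps)
    then have "(A / w) ^ p < (4.92 + 3.6 * \<epsilon>) ^ p"
      using A w elim by (intro power_strict_mono) auto
    then show ?case using 1 D by (auto intro: divide_strict_right_mono)
  qed
  then obtain N where "\<forall>p\<ge>N.
    ee_M p (stab_region p \<inter> left_half_plane) \<le> ereal ((A / w) ^ p / (B * sqrt (real p - 1))) \<and>
    (A / w) ^ p / (B * sqrt (real p - 1)) < (4.92 + 3.6 * \<epsilon>) ^ p / (B * sqrt (real p - 1))"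
    unfolding eventually_sequentially by blast
  then show ?thesis unfolding w_def A_def B_def by (intro exI[of _ "Suc N"]) auto
qed

end
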